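(* Let $K$ be a finite weighted simplicial complex and fix $p\ge 0$. Let $B_p$ be the $p$-th boundary matrix. For any $p$-simplex $\sigma$, let $w(\sigma)$ and $r_\sigma$ be the weight and the effective resistance of $\sigma$, respectively. Then $$\sum_{\sigma\in K_p}w(\sigma)\,r_\sigma=\operatorname{rank}(B_p^\top)=n_{p-1}-\operatorname{null}(B_p^\top).$$
   Context: $K$ is a finite simplicial complex with ordered vertices; $K_p$ is its set of $p$-simplices, $n_p=|K_p|$, with weights $w=w_p:K_p\to\mathbb{R}_{>0}$. $C_p(K)$ is the real vector space on the oriented $p$-simplices ($C_{-1}(K)=0$, $n_{-1}=0$), with boundary maps $\partial_p:C_p(K)\to C_{p-1}(K)$, whose matrix in the bases of oriented simplices is $B_p$, and inner product $\langle\sigma,\tau\rangle_{C_p}=w_p(\sigma)^{-1}$ if $\sigma=\tau$, $0$ otherwise, extended bilinearly. $\partial_p^{*}$ is the adjoint of $\partial_p$, $\mathcal{L}^{\mathrm{up}}_{p-1}=\partial_p\partial_p^{*}$, and $^{+}$ is the Moore–Penrose pseudoinverse with respect to these inner products. The effective resistance of a $p$-simplex $\sigma$ is $r_\sigma=\mathcal{R}_p(\sigma,\sigma)=\langle\partial_p^{*}(\mathcal{L}^{\mathrm{up}}_{p-1})^{+}\partial_p\sigma,\sigma\rangle_{C_p}$. $\operatorname{null}(\cdot)$ denotes the dimension of the kernel. *)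

theory Defs
  imports Complex_Main "HOL-Library.FuncSet" "HOL-Library.Indicator_Function"
    "HOL-Library.List_Lexorder"
    "Jordan_Normal_Form.DL_Rank" "Jordan_Normal_Form.Matrix_Kernel"
begin

text \<open>Simplices are sets of vertices; the order of the vertices is the order of the type.
  The empty set is not a simplex.\<close>

definition finite_simplicial_complex :: "'a set set \<Rightarrow> bool" where
  "finite_simplicial_complex K \<longleftrightarrow>
     finite K \<and> (\<forall>\<sigma>\<in>K. finite \<sigma> \<and> \<sigma> \<noteq> {}) \<and>
     (\<forall>\<sigma>\<in>K. \<forall>\<tau>. \<tau> \<subseteq> \<sigma> \<and> \<tau> \<noteq> {} \<longrightarrow> \<tau> \<in> K)"

text \<open>The dimension is an integer, so that degree \<open>p - 1\<close> makes sense for \<open>p = 0\<close>;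
  for a simplicial complex \<open>K\<close>, \<open>simplices K (- 1)\<close> is empty and \<open>chains K (- 1)\<close>
  is the zero space.\<close>

definition simplices :: "'a set set \<Rightarrow> int \<Rightarrow> 'a set set" where
  "simplices K p = {\<sigma> \<in> K. int (card \<sigma>) = p + 1}"

text \<open>A chain is its family of coordinates in the basis of the \<open>p\<close>-simplices, each oriented by
  the increasing order of its vertices; the basis chain of \<open>\<sigma>\<close> is \<open>indicator {\<sigma>}\<close>.\<close>

definition chains :: "'a set set \<Rightarrow> int \<Rightarrow> ('a set \<Rightarrow> real) set" where
  "chains K p = {c. \<forall>\<sigma>. \<sigma> \<notin> simplices K p \<longrightarrow> c \<sigma> = 0}"

definition chain_inner ::
    "'a set set \<Rightarrow> ('a set \<Rightarrow> real) \<Rightarrow> int \<Rightarrow> ('a set \<Rightarrow> real) \<Rightarrow> ('a set \<Rightarrow> real) \<Rightarrow> real" where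
  "chain_inner K w p c d = (\<Sum>\<sigma>\<in>simplices K p. inverse (w \<sigma>) * c \<sigma> * d \<sigma>)"

text \<open>Linear maps between chain spaces are extensional functions, so that two of them are equal
  if they agree on all chains.\<close>

definition chain_maps ::
    "'a set set \<Rightarrow> int \<Rightarrow> int \<Rightarrow> (('a set \<Rightarrow> real) \<Rightarrow> ('a set \<Rightarrow> real)) set" where
  "chain_maps K p q = {f \<in> chains K p \<rightarrow>\<^sub>E chains K q.
     \<forall>a b. \<forall>c\<in>chains K p. \<forall>d\<in>chains K p.
       f (\<lambda>\<sigma>. a * c \<sigma> + b * d \<sigma>) = (\<lambda>\<tau>. a * f c \<tau> + b * f d \<tau>)}"

text \<open>On the simplex \<open>\<sigma>\<close> with vertices \<open>v\<^sub>0 < \<dots> < v\<^sub>p\<close> this is the sum of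
  \<open>(- 1) ^ j * (\<sigma> - {v\<^sub>j})\<close> over \<open>j\<close>, as \<open>j\<close> is the number of vertices of \<open>\<sigma>\<close> below \<open>v\<^sub>j\<close>.
  The case distinction matters for \<open>p = 0\<close> only, where it discards the empty face.\<close>

definition boundary ::
    "'a::linorder set set \<Rightarrow> int \<Rightarrow> ('a set \<Rightarrow> real) \<Rightarrow> ('a set \<Rightarrow> real)" where
  "boundary K p = (\<lambda>c\<in>chains K p. \<lambda>\<tau>.
     if \<tau> \<in> simplices K (p - 1)
     then \<Sum>\<sigma>\<in>simplices K p. c \<sigma> *
            (\<Sum>v\<in>\<sigma>. (- 1) ^ card {u \<in> \<sigma>. u < v} * indicator {\<sigma> - {v}} \<tau>)
     else 0)"

text \<open>The \<open>p\<close>-simplices in the lexicographic order of their increasing vertex lists.\<close>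

definition simplex_list :: "'a::linorder set set \<Rightarrow> int \<Rightarrow> 'a set list" where
  "simplex_list K p =
     map set (sorted_list_of_set ((\<lambda>\<sigma>. sorted_list_of_set \<sigma>) ` simplices K p))"

definition boundary_matrix :: "'a::linorder set set \<Rightarrow> int \<Rightarrow> real mat" where
  "boundary_matrix K p = mat (card (simplices K (p - 1))) (card (simplices K p))
     (\<lambda>(i, j). boundary K p (indicator {simplex_list K p ! j}) (simplex_list K (p - 1) ! i))"

definition chain_adjoint ::
    "'a set set \<Rightarrow> ('a set \<Rightarrow> real) \<Rightarrow> int \<Rightarrow> int \<Rightarrow> (('a set \<Rightarrow> real) \<Rightarrow> ('a set \<Rightarrow> real))
       \<Rightarrow> (('a set \<Rightarrow> real) \<Rightarrow> ('a set \<Rightarrow> real))" where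
  "chain_adjoint K w p q f = (THE g. g \<in> chain_maps K q p \<and>
     (\<forall>c\<in>chains K p. \<forall>d\<in>chains K q. chain_inner K w q (f c) d = chain_inner K w p c (g d)))"

text \<open>The Moore--Penrose inverse: the four Penrose conditions, with adjoints taken for the weighted
  inner products.\<close>

definition chain_pinv ::
    "'a set set \<Rightarrow> ('a set \<Rightarrow> real) \<Rightarrow> int \<Rightarrow> int \<Rightarrow> (('a set \<Rightarrow> real) \<Rightarrow> ('a set \<Rightarrow> real))
       \<Rightarrow> (('a set \<Rightarrow> real) \<Rightarrow> ('a set \<Rightarrow> real))" where
  "chain_pinv K w p q f = (THE g. g \<in> chain_maps K q p \<and>
     (\<forall>c\<in>chains K p. f (g (f c)) = f c) \<and>
     (\<forall>d\<in>chains K q. g (f (g d)) = g d) \<and>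
     chain_adjoint K w q q (compose (chains K q) f g) = compose (chains K q) f g \<and>
     chain_adjoint K w p p (compose (chains K p) g f) = compose (chains K p) g f)"

definition boundary_adjoint ::
    "'a::linorder set set \<Rightarrow> ('a set \<Rightarrow> real) \<Rightarrow> int \<Rightarrow> ('a set \<Rightarrow> real) \<Rightarrow> ('a set \<Rightarrow> real)" where
  "boundary_adjoint K w p = chain_adjoint K w p (p - 1) (boundary K p)"

definition up_laplacian ::
    "'a::linorder set set \<Rightarrow> ('a set \<Rightarrow> real) \<Rightarrow> int \<Rightarrow> ('a set \<Rightarrow> real) \<Rightarrow> ('a set \<Rightarrow> real)" where
  "up_laplacian K w q = compose (chains K q) (boundary K (q + 1)) (boundary_adjoint K w (q + 1))"

definition effective_resistance ::
    "'a::linorder set set \<Rightarrow> ('a set \<Rightarrow> real) \<Rightarrow> int \<Rightarrow> 'a set \<Rightarrow> real" where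
  "effective_resistance K w p \<sigma> =
     chain_inner K w p
       (boundary_adjoint K w p
         (chain_pinv K w (p - 1) (p - 1) (up_laplacian K w (p - 1))
           (boundary K p (indicator {\<sigma>}))))
       (indicator {\<sigma>})"

definition mat_rank :: "real mat \<Rightarrow> nat" where
  "mat_rank A = vec_space.rank (dim_row A) A"

end

theory Submission
  imports Defs
begin

text \<open>
  Let \<open>L = \<partial> \<partial>*\<close> and \<open>P = \<partial>* L\<^sup>+ \<partial>\<close>. The number \<open>w(\<sigma>) r\<^sub>\<sigma>\<close> is the \<open>\<sigma>\<close>-th diagonal entry of \<open>P\<close>
  in the basis of simplices, because the weight cancels the factor \<open>w(\<sigma>)\<^sup>-\<^sup>1\<close> of the inner
  product; so the sum of the theorem is the trace of \<open>P\<close>. Now \<open>P\<close> takes values in the range of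
  \<open>\<partial>*\<close> and fixes that range pointwise, because \<open>L z = 0\<close> implies \<open>\<partial>* z = 0\<close>
  (\<open>adjoint_pinv_laplacian\<close>). Thus \<open>P\<close> is a projection onto the range of \<open>\<partial>*\<close>, and the trace of
  a projection is the dimension of its range (\<open>trace_projection_eq_rank\<close>).

  In coordinates \<open>\<partial>* = W\<^sub>p B\<^sup>T W\<^sub>q\<^sup>-\<^sup>1\<close> for \<open>q = p - 1\<close> and the diagonal matrices \<open>W\<close> of the
  weights. The conjugate \<open>W\<^sub>p\<^sup>-\<^sup>1 P W\<^sub>p\<close> has the trace of \<open>P\<close> and is a projection onto the column
  space of \<open>B\<^sup>T\<close>, so the trace is the rank of \<open>B\<^sup>T\<close> itself
  (\<open>weighted_resistance_sum_eq_rank\<close>). The second equality is the dimension formula for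
  \<open>B\<^sup>T\<close>.

  Adjoints and pseudoinverses are given by definite descriptions, so both need existence and
  uniqueness. The adjoint is determined by its values against the basis chains. For the
  pseudoinverse of a self-adjoint \<open>L\<close>, orthogonal projections onto the range of \<open>L\<close> exist
  (\<open>orthogonal_projection_exists\<close>); hence every chain is the sum of one in the range and one in
  the kernel of \<open>L\<close>, and \<open>L\<close> is injective on its range, where it can be inverted
  (\<open>self_adjoint_penrose_inverse\<close>).
\<close>

section \<open>Rank, nullity and the trace of a projection\<close>

lemma rank_plus_kernel_dim:
  fixes A :: "'a::field mat"
  assumes A: "A \<in> carrier_mat n m"
  shows "vec_space.rank n A + kernel_dim A = m"
proof -
  interpret W: vec_space "TYPE('a)" n .
  interpret ker: kernel n m A by unfold_locales (rule A)
  interpret T: linear_map class_ring ker.NC.V W.V "\<lambda>v. A *\<^sub>v v"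
    by unfold_locales
      (use A in \<open>auto simp: LinearCombinations.module_hom_def mult_add_distrib_mat_vec mult_mat_vec
        module_vec_simps\<close>)
  have im: "T.imT = W.span (set (cols A))"
    using W.col_space_eq[OF A] A by (auto simp: T.im_def W.col_space_def)
  have ker: "T.kerT = mat_kernel A"
    using A by (auto simp: T.ker_def mat_kernel[OF A])
  show ?thesis
    using T.rank_nullity[OF ker.NC.fin_dim] ker.NC.dim_is_n ker.kernel_dim
    by (simp add: im ker W.rank_def)
qed

text \<open>As \<open>A X A = A\<close>, the matrix \<open>A X\<close> is a projection onto the column space of \<open>A\<close>. With a basis
  \<open>S\<close> of that space and coordinates \<open>a\<^sub>j s\<close> of the columns of \<open>A X\<close>, the trace is the sum over \<open>s\<close>
  of the values at \<open>s\<close> of the functionals \<open>v \<mapsto> (\<Sum>j. a\<^sub>j s * v\<^sub>j)\<close>. These are dual to \<open>S\<close>, as \<open>A X\<close>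
  fixes every element of \<open>S\<close>; so each \<open>s\<close> contributes \<open>1\<close>.\<close>

lemma trace_projection_eq_rank:
  fixes A :: "'a::field mat"
  assumes A: "A \<in> carrier_mat n m" and X: "X \<in> carrier_mat m n"
    and fix_cols: "A * X * A = A"
  shows "(\<Sum>i<n. (A * X) $$ (i, i)) = of_nat (vec_space.rank n A)"
proof -
  interpret vec_space "TYPE('a)" n .
  define Q where "Q = A * X"
  have Q: "Q \<in> carrier_mat n n" using A X by (simp add: Q_def)
  have colsA: "set (cols A) \<subseteq> carrier_vec n" using A cols_dim by blast
  obtain S where S: "finite S" "maximal S (\<lambda>T. T \<subseteq> set (cols A) \<and> lin_indpt T)"
    using maximal_exists_superset[of "set (cols A)" "\<lambda>T. T \<subseteq> set (cols A) \<and> lin_indpt T" "{}"]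
    by (auto simp: lin_dep_def)
  have S_sub: "S \<subseteq> set (cols A)" and li: "lin_indpt S" using S(2) by (auto simp: maximal_def)
  have S_carrier: "S \<subseteq> carrier_vec n" using S_sub colsA by blast
  have "span S = span (set (cols A))"
  proof -
    have "set (cols A) \<subseteq> span S"
    proof
      fix v assume v: "v \<in> set (cols A)"
      show "v \<in> span S"
      proof (rule ccontr)
        assume nv: "v \<notin> span S"
        have "v \<notin> S" using nv S_carrier span_mem by blast
        moreover have "lin_indpt (S \<union> {v})"
          using lin_dep_iff_in_span[OF S_carrier li _ \<open>v \<notin> S\<close>] nv v colsA by auto
        ultimately show False using S(2) S_sub v unfolding maximal_def by blast
      qed
    qed
    then show ?thesis
      using span_subsetI[OF S_carrier] span_is_monotone[OF S_sub] by blast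
  qed
  then have in_span: "A *\<^sub>v x \<in> span S" if "x \<in> carrier_vec m" for x
    using col_space_eq[OF A] that A by (auto simp: col_space_def)
  have "\<exists>a. col Q j = lincomb a S" if "j < n" for j
  proof -
    have "col Q j = A *\<^sub>v col X j" unfolding Q_def using that X by (intro col_mult2[OF A X])
    then have "col Q j \<in> span S" using in_span[of "col X j"] X that by auto
    then show ?thesis using finite_in_span[OF S(1) S_carrier] by metis
  qed
  then obtain a where a: "\<And>j. j < n \<Longrightarrow> col Q j = lincomb (a j) S" by metis
  have entry: "Q $$ (i, j) = (\<Sum>s\<in>S. a j s * s $ i)" if "i < n" "j < n" for i j
    using lincomb_index[OF that(1) S_carrier] a[OF that(2)] Q that by (metis carrier_matD index_col)
  have dual: "(\<Sum>j<n. a j s * t $ j) = (if s = t then 1 else 0)" if s: "s \<in> S" and t: "t \<in> S" for s t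
  proof -
    obtain k where k: "k < m" "t = col A k" using t S_sub A by (auto simp: cols_def)
    have "Q *\<^sub>v t = t" using k fix_cols A Q
      by (metis Q_def col_mult2)
    let ?b = "\<lambda>s. (\<Sum>j<n. a j s * t $ j) - (if s = t then 1 else 0)"
    have tc: "t \<in> carrier_vec n" using t S_carrier by blast
    have "lincomb ?b S = 0\<^sub>v n"
    proof (rule eq_vecI)
      fix i assume "i < dim_vec (0\<^sub>v n :: 'a vec)"
      then have i: "i < n" by simp
      have "lincomb ?b S $ i = (\<Sum>s\<in>S. ?b s * s $ i)" by (rule lincomb_index[OF i S_carrier])
      also have "\<dots> = (\<Sum>s\<in>S. \<Sum>j<n. a j s * t $ j * s $ i) - (\<Sum>s\<in>S. (if s = t then 1 else 0) * s $ i)"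
        by (simp add: left_diff_distrib sum_subtractf sum_distrib_right)
      also have "(\<Sum>s\<in>S. (if s = t then 1 else 0) * s $ i) = t $ i"
        using S(1) t by (simp add: if_distrib[of "\<lambda>x. x * _"] cong: if_cong)
      also have "(\<Sum>s\<in>S. \<Sum>j<n. a j s * t $ j * s $ i) = (\<Sum>j<n. Q $$ (i, j) * t $ j)"
        by (subst sum.swap) (auto simp: entry i sum_distrib_right intro!: sum.cong)
      also have "\<dots> = (Q *\<^sub>v t) $ i"
        using Q tc i by (auto simp: scalar_prod_def lessThan_atLeast0 intro!: sum.cong)
      finally show "lincomb ?b S $ i = 0\<^sub>v n $ i" using \<open>Q *\<^sub>v t = t\<close> i by simp
    qed (use lincomb_dim[OF S(1) S_carrier] in simp)
    then have "?b \<in> S \<rightarrow> {0}"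
      using not_lindepD[OF li S(1) subset_refl, of ?b] by auto
    then show ?thesis using s by (auto simp: Pi_def)
  qed
  have "(\<Sum>i<n. Q $$ (i, i)) = (\<Sum>s\<in>S. \<Sum>i<n. a i s * s $ i)"
    by (subst sum.swap) (auto simp: entry intro!: sum.cong)
  also have "\<dots> = of_nat (card S)" using dual by simp
  also have "card S = rank A" using rank_card_indpt[OF A S(2)] ..
  finally show ?thesis by (simp add: Q_def)
qed
section \<open>Chains, chain maps and adjoints\<close>

locale weighted_complex =
  fixes K :: "'a::linorder set set" and w :: "'a set \<Rightarrow> real"
  assumes complex: "finite_simplicial_complex K"
    and weight_pos: "\<forall>\<sigma>\<in>K. w \<sigma> > 0"
begin

lemma finite_simplices: "finite (simplices K p)"
  using complex by (simp add: finite_simplicial_complex_def simplices_def)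

lemma simplex_weight_pos: "\<sigma> \<in> simplices K p \<Longrightarrow> w \<sigma> > 0"
  using weight_pos by (simp add: simplices_def)

lemma chains_lincomb:
  "c \<in> chains K p \<Longrightarrow> d \<in> chains K p \<Longrightarrow> (\<lambda>\<sigma>. a * c \<sigma> + b * d \<sigma>) \<in> chains K p"
  by (simp add: chains_def)

lemma chains_diff:
  "c \<in> chains K p \<Longrightarrow> d \<in> chains K p \<Longrightarrow> (\<lambda>\<sigma>. c \<sigma> - d \<sigma>) \<in> chains K p"
  by (simp add: chains_def)

lemma zero_in_chains: "(\<lambda>\<sigma>. 0) \<in> chains K p"
  by (simp add: chains_def)

lemma indicator_in_chains: "\<sigma> \<in> simplices K p \<Longrightarrow> indicator {\<sigma>} \<in> chains K p"
  by (auto simp: chains_def indicator_def)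

lemma chain_map_in_chains: "f \<in> chain_maps K p q \<Longrightarrow> c \<in> chains K p \<Longrightarrow> f c \<in> chains K q"
  by (auto simp: chain_maps_def)

lemma chain_map_lincomb:
  "f \<in> chain_maps K p q \<Longrightarrow> c \<in> chains K p \<Longrightarrow> d \<in> chains K p \<Longrightarrow>
    f (\<lambda>\<sigma>. a * c \<sigma> + b * d \<sigma>) = (\<lambda>\<tau>. a * f c \<tau> + b * f d \<tau>)"
  by (auto simp: chain_maps_def)

lemma chain_map_diff:
  "f \<in> chain_maps K p q \<Longrightarrow> c \<in> chains K p \<Longrightarrow> d \<in> chains K p \<Longrightarrow>
    f (\<lambda>\<sigma>. c \<sigma> - d \<sigma>) = (\<lambda>\<tau>. f c \<tau> - f d \<tau>)"
  using chain_map_lincomb[of f p q c d 1 "-1"] by simp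

lemma chain_map_zero: "f \<in> chain_maps K p q \<Longrightarrow> f (\<lambda>\<sigma>. 0) = (\<lambda>\<tau>. 0)"
  using chain_map_lincomb[of f p q "\<lambda>\<sigma>. 0" "\<lambda>\<sigma>. 0" 0 0] by (simp add: zero_in_chains)

lemma chain_map_ext:
  assumes "f \<in> chain_maps K p q" "g \<in> chain_maps K p q" "\<And>c. c \<in> chains K p \<Longrightarrow> f c = g c"
  shows "f = g"
  using assms by (auto simp: chain_maps_def intro: PiE_ext)

lemma chain_map_compose:
  assumes "f \<in> chain_maps K p q" "g \<in> chain_maps K r p"
  shows "compose (chains K r) f g \<in> chain_maps K r q"
  using assms chains_lincomb
  by (auto simp: chain_maps_def compose_def PiE_iff chains_lincomb intro!: restrict_ext)

lemma chain_map_expand: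
  assumes f: "f \<in> chain_maps K p q" and c: "c \<in> chains K p"
  shows "f c \<tau> = (\<Sum>\<sigma>\<in>simplices K p. c \<sigma> * f (indicator {\<sigma>}) \<tau>)"
proof -
  \<comment> \<open>Induction on a set that contains the support, removing the coordinate at one simplex.\<close>
  have "f c \<tau> = (\<Sum>\<sigma>\<in>T. c \<sigma> * f (indicator {\<sigma>}) \<tau>)"
    if "finite T" "T \<subseteq> simplices K p" "c \<in> chains K p" "\<forall>\<sigma>. \<sigma> \<notin> T \<longrightarrow> c \<sigma> = 0" for T c
    using that
  proof (induction T arbitrary: c rule: finite_induct)
    case empty
    then have "c = (\<lambda>\<sigma>. 0)" by auto
    then show ?case using chain_map_zero[OF f] by simp
  next
    case (insert s T)
    let ?c = "\<lambda>\<sigma>. 1 * c \<sigma> + (- c s) * indicator {s} \<sigma>"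
    have s: "indicator {s} \<in> chains K p" using insert.prems by (intro indicator_in_chains) simp
    have c': "?c \<in> chains K p" using chains_lincomb[OF insert.prems(2) s] .
    have "f ?c \<tau> = (\<Sum>\<sigma>\<in>T. ?c \<sigma> * f (indicator {\<sigma>}) \<tau>)"
      using insert.prems c' by (intro insert.IH) (auto simp: indicator_def)
    also have "\<dots> = (\<Sum>\<sigma>\<in>T. c \<sigma> * f (indicator {\<sigma>}) \<tau>)"
      using insert.hyps by (intro sum.cong) (auto simp: indicator_def)
    finally show ?case
      using insert.hyps chain_map_lincomb[OF f insert.prems(2) s, of 1 "- c s"] by simp
  qed
  from this[OF finite_simplices subset_refl c] c show ?thesis by (auto simp: chains_def)
qed

lemma chain_inner_commute: "chain_inner K w p c d = chain_inner K w p d c"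
  by (simp add: chain_inner_def mult_ac)

lemma chain_inner_lincomb_left:
  "chain_inner K w p (\<lambda>\<sigma>. a * c \<sigma> + b * d \<sigma>) e =
    a * chain_inner K w p c e + b * chain_inner K w p d e"
  by (simp add: chain_inner_def sum_distrib_left sum.distrib algebra_simps)

lemma chain_inner_diff_left:
  "chain_inner K w p (\<lambda>\<sigma>. c \<sigma> - d \<sigma>) e = chain_inner K w p c e - chain_inner K w p d e"
  using chain_inner_lincomb_left[of p 1 c "-1" d e] by simp

lemma chain_inner_lincomb_right:
  "chain_inner K w p e (\<lambda>\<sigma>. a * c \<sigma> + b * d \<sigma>) =
    a * chain_inner K w p e c + b * chain_inner K w p e d"
  using chain_inner_lincomb_left chain_inner_commute by metis

lemma chain_inner_diff_right:
  "chain_inner K w p e (\<lambda>\<sigma>. c \<sigma> - d \<sigma>) = chain_inner K w p e c - chain_inner K w p e d"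
  using chain_inner_diff_left chain_inner_commute by metis

lemma chain_inner_zero_left: "chain_inner K w p (\<lambda>\<sigma>. 0) e = 0"
  by (simp add: chain_inner_def)

lemma chain_inner_indicator_right:
  "\<sigma> \<in> simplices K p \<Longrightarrow> chain_inner K w p c (indicator {\<sigma>}) = inverse (w \<sigma>) * c \<sigma>"
  using finite_simplices by (simp add: chain_inner_def indicator_def if_distrib cong: if_cong)

lemma chain_inner_self_eq_0:
  assumes c: "c \<in> chains K p" and 0: "chain_inner K w p c c = 0"
  shows "c = (\<lambda>\<sigma>. 0)"
proof
  fix \<sigma>
  have "\<forall>\<sigma>\<in>simplices K p. inverse (w \<sigma>) * c \<sigma> * c \<sigma> = 0"
    using 0 unfolding chain_inner_def
    by (subst (asm) sum_nonneg_eq_0_iff)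
      (auto simp: finite_simplices mult.assoc
        intro!: mult_nonneg_nonneg[OF _ zero_le_square] less_imp_le[OF simplex_weight_pos])
  then show "c \<sigma> = 0"
    using c simplex_weight_pos[of \<sigma> p] by (cases "\<sigma> \<in> simplices K p") (auto simp: chains_def)
qed

lemma chain_eqI_inner:
  assumes "c \<in> chains K p" "d \<in> chains K p"
    and "\<And>e. e \<in> chains K p \<Longrightarrow> chain_inner K w p c e = chain_inner K w p d e"
  shows "c = d"
proof -
  have "(\<lambda>\<sigma>. c \<sigma> - d \<sigma>) = (\<lambda>\<sigma>. 0)"
    by (rule chain_inner_self_eq_0[of _ p])
      (use assms chains_diff in \<open>simp_all add: chain_inner_diff_left\<close>)
  then show ?thesis by (simp add: fun_eq_iff)
qed

lemma chain_adjoint_eqI: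
  assumes f: "f \<in> chain_maps K p q" and g: "g \<in> chain_maps K q p"
    and adj: "\<And>c d. c \<in> chains K p \<Longrightarrow> d \<in> chains K q \<Longrightarrow>
      chain_inner K w q (f c) d = chain_inner K w p c (g d)"
  shows "chain_adjoint K w p q f = g"
  unfolding chain_adjoint_def
proof (rule the_equality)
  fix h assume h: "h \<in> chain_maps K q p \<and> (\<forall>c\<in>chains K p. \<forall>d\<in>chains K q.
    chain_inner K w q (f c) d = chain_inner K w p c (h d))"
  show "h = g"
  proof (rule chain_map_ext[of _ q p])
    fix d assume d: "d \<in> chains K q"
    show "h d = g d"
      by (rule chain_eqI_inner[of _ p])
        (use h g d adj in \<open>auto simp: chain_inner_commute[of p "_ d"] intro: chain_map_in_chains\<close>)
  qed (use h g in auto)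
qed (use g adj in auto)

text \<open>Pairing with the basis chain of \<open>\<sigma>\<close> reads off \<open>w(\<sigma>)\<^sup>-\<^sup>1\<close> times the coordinate at \<open>\<sigma>\<close>, which
  leaves only one candidate for the adjoint; its adjointness extends from basis chains to all
  chains by linearity.\<close>

lemma
  assumes f: "f \<in> chain_maps K p q"
  shows chain_adjoint_in_chain_maps: "chain_adjoint K w p q f \<in> chain_maps K q p" (is ?in)
    and chain_inner_adjoint: "c \<in> chains K p \<Longrightarrow> d \<in> chains K q \<Longrightarrow>
      chain_inner K w q (f c) d = chain_inner K w p c (chain_adjoint K w p q f d)" (is "_ \<Longrightarrow> _ \<Longrightarrow> ?adj c d")
proof -
  define g where "g = (\<lambda>d\<in>chains K q. \<lambda>\<sigma>.
    if \<sigma> \<in> simplices K p then w \<sigma> * chain_inner K w q (f (indicator {\<sigma>})) d else 0)"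
  have g: "g \<in> chain_maps K q p"
    by (auto simp: chain_maps_def g_def chains_lincomb chain_inner_lincomb_right fun_eq_iff algebra_simps)
      (auto simp: chains_def)
  have adj: "chain_inner K w q (f c) d = chain_inner K w p c (g d)"
    if c: "c \<in> chains K p" and d: "d \<in> chains K q" for c d
  proof -
    have "chain_inner K w q (f c) d = (\<Sum>\<tau>\<in>simplices K q. \<Sum>\<sigma>\<in>simplices K p.
        inverse (w \<tau>) * (c \<sigma> * f (indicator {\<sigma>}) \<tau>) * d \<tau>)"
      by (simp add: chain_inner_def chain_map_expand[OF f c] sum_distrib_left sum_distrib_right)
    also have "\<dots> = (\<Sum>\<sigma>\<in>simplices K p. c \<sigma> * chain_inner K w q (f (indicator {\<sigma>})) d)"
      by (subst sum.swap) (simp add: chain_inner_def sum_distrib_left mult_ac)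
    also have "\<dots> = chain_inner K w p c (g d)"
      unfolding chain_inner_def[of _ _ p]
    proof (intro sum.cong refl)
      fix \<sigma> assume \<sigma>: "\<sigma> \<in> simplices K p"
      then show "c \<sigma> * chain_inner K w q (f (indicator {\<sigma>})) d = inverse (w \<sigma>) * c \<sigma> * g d \<sigma>"
        using simplex_weight_pos[OF \<sigma>] d by (simp add: g_def)
    qed
    finally show ?thesis .
  qed
  have "chain_adjoint K w p q f = g" by (rule chain_adjoint_eqI[OF f g adj])
  then show ?in "c \<in> chains K p \<Longrightarrow> d \<in> chains K q \<Longrightarrow> ?adj c d" using g adj by auto
qed

lemma chain_adjoint_apply:
  assumes f: "f \<in> chain_maps K p q" and d: "d \<in> chains K q" and \<sigma>: "\<sigma> \<in> simplices K p"
  shows "chain_adjoint K w p q f d \<sigma> = w \<sigma> * chain_inner K w q (f (indicator {\<sigma>})) d"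
proof -
  have "chain_inner K w q (f (indicator {\<sigma>})) d = inverse (w \<sigma>) * chain_adjoint K w p q f d \<sigma>"
    using chain_inner_adjoint[OF f indicator_in_chains[OF \<sigma>] d]
      chain_inner_indicator_right[OF \<sigma>] chain_inner_commute by metis
  then show ?thesis using simplex_weight_pos[OF \<sigma>] by simp
qed

section \<open>The pseudoinverse of a self-adjoint chain map\<close>

text \<open>This is the Gram--Schmidt process: the range of \<open>f\<close> is spanned by the images of the basis
  chains, and these are treated one after the other.\<close>

lemma orthogonal_projection_exists:
  assumes f: "f \<in> chain_maps K p q" and d: "d \<in> chains K q"
  shows "\<exists>c\<in>chains K p. \<forall>e\<in>chains K p. chain_inner K w q (\<lambda>\<tau>. d \<tau> - f c \<tau>) (f e) = 0"
proof -
  have "\<exists>c\<in>chains K p. (\<forall>\<sigma>. \<sigma> \<notin> T \<longrightarrow> c \<sigma> = 0) \<and> (\<forall>e\<in>chains K p. (\<forall>\<sigma>. \<sigma> \<notin> T \<longrightarrow> e \<sigma> = 0) \<longrightarrow>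
      chain_inner K w q (\<lambda>\<tau>. d \<tau> - f c \<tau>) (f e) = 0)"
    if "finite T" "T \<subseteq> simplices K p" "d \<in> chains K q" for T d
    using that
  proof (induction T arbitrary: d rule: finite_induct)
    case empty
    have "f e = (\<lambda>\<tau>. 0)" if "\<forall>\<sigma>. \<sigma> \<notin> {} \<longrightarrow> e \<sigma> = 0" for e
    proof -
      have "e = (\<lambda>\<sigma>. 0)" using that by (simp add: fun_eq_iff)
      then show ?thesis using chain_map_zero[OF f] by simp
    qed
    then show ?case
      by (intro bexI[of _ "\<lambda>\<sigma>. 0"] conjI ballI impI) (simp_all add: chain_inner_def zero_in_chains)
  next
    case (insert s T)
    have s: "indicator {s} \<in> chains K p" using insert.prems by (intro indicator_in_chains) simp
    obtain b where b: "b \<in> chains K p" "\<forall>\<sigma>. \<sigma> \<notin> T \<longrightarrow> b \<sigma> = 0" and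
      b_orth: "\<And>e. e \<in> chains K p \<Longrightarrow> \<forall>\<sigma>. \<sigma> \<notin> T \<longrightarrow> e \<sigma> = 0 \<Longrightarrow>
        chain_inner K w q (\<lambda>\<tau>. d \<tau> - f b \<tau>) (f e) = 0"
      using insert.IH[of d] insert.prems by auto
    obtain a where a: "a \<in> chains K p" "\<forall>\<sigma>. \<sigma> \<notin> T \<longrightarrow> a \<sigma> = 0" and
      a_orth: "\<And>e. e \<in> chains K p \<Longrightarrow> \<forall>\<sigma>. \<sigma> \<notin> T \<longrightarrow> e \<sigma> = 0 \<Longrightarrow>
        chain_inner K w q (\<lambda>\<tau>. f (indicator {s}) \<tau> - f a \<tau>) (f e) = 0"
      using insert.IH[of "f (indicator {s})"] insert.prems chain_map_in_chains[OF f s] by auto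
    \<comment> \<open>\<open>f u\<close> is the component of the new generator orthogonal to the span of the old ones, and \<open>t\<close>
      is the coefficient of the residual \<open>r\<close> along it. If \<open>f u = 0\<close>, the new generator adds
      nothing, and the value \<open>t = 0\<close> of the division by zero is the right one.\<close>
    define u where "u = (\<lambda>\<sigma>. indicator {s} \<sigma> - a \<sigma>)"
    have u: "u \<in> chains K p" unfolding u_def by (rule chains_diff[OF s a(1)])
    have fu: "f u = (\<lambda>\<tau>. f (indicator {s}) \<tau> - f a \<tau>)"
      unfolding u_def by (rule chain_map_diff[OF f s a(1)])
    have fuq: "f u \<in> chains K q" by (rule chain_map_in_chains[OF f u])
    define r where "r = (\<lambda>\<tau>. d \<tau> - f b \<tau>)"
    define t where "t = chain_inner K w q r (f u) / chain_inner K w q (f u) (f u)"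
    have t: "t * chain_inner K w q (f u) (f u) = chain_inner K w q r (f u)"
    proof (cases "chain_inner K w q (f u) (f u) = 0")
      case True
      then have "f u = (\<lambda>\<tau>. 0)" using chain_inner_self_eq_0[OF fuq] by simp
      then show ?thesis using chain_inner_zero_left chain_inner_commute by (metis mult_zero_right)
    qed (simp add: t_def)
    define c where "c = (\<lambda>\<sigma>. 1 * b \<sigma> + t * u \<sigma>)"
    have res: "(\<lambda>\<tau>. d \<tau> - f c \<tau>) = (\<lambda>\<tau>. 1 * r \<tau> + (- t) * f u \<tau>)"
      unfolding c_def by (subst chain_map_lincomb[OF f b(1) u]) (simp add: r_def algebra_simps)
    have "chain_inner K w q (\<lambda>\<tau>. d \<tau> - f c \<tau>) (f e) = 0"
      if e: "e \<in> chains K p" "\<forall>\<sigma>. \<sigma> \<notin> insert s T \<longrightarrow> e \<sigma> = 0" for e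
    proof -
      define e' where "e' = (\<lambda>\<sigma>. 1 * e \<sigma> + (- e s) * u \<sigma>)"
      have e': "e' \<in> chains K p" unfolding e'_def by (rule chains_lincomb[OF e(1) u])
      have supp: "\<forall>\<sigma>. \<sigma> \<notin> T \<longrightarrow> e' \<sigma> = 0"
        using e(2) a(2) insert.hyps by (auto simp: e'_def u_def indicator_def)
      have "e = (\<lambda>\<sigma>. 1 * e' \<sigma> + e s * u \<sigma>)" by (simp add: e'_def fun_eq_iff)
      then have fe: "f e = (\<lambda>\<tau>. 1 * f e' \<tau> + e s * f u \<tau>)"
        using chain_map_lincomb[OF f e' u, of 1 "e s"] by simp
      have "chain_inner K w q r (f e') = 0" "chain_inner K w q (f u) (f e') = 0"
        using b_orth[OF e' supp] a_orth[OF e' supp] by (simp_all add: r_def fu)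
      then show ?thesis
        unfolding res fe chain_inner_lincomb_left chain_inner_lincomb_right
        using t by (simp add: algebra_simps)
    qed
    moreover have "c \<in> chains K p" unfolding c_def by (rule chains_lincomb[OF b(1) u])
    moreover have "\<forall>\<sigma>. \<sigma> \<notin> insert s T \<longrightarrow> c \<sigma> = 0"
      using a(2) b(2) by (auto simp: c_def u_def indicator_def)
    ultimately show ?case by blast
  qed
  from this[OF finite_simplices subset_refl d] show ?thesis by (auto simp: chains_def)
qed

definition self_adjoint_on :: "int \<Rightarrow> (('a set \<Rightarrow> real) \<Rightarrow> ('a set \<Rightarrow> real)) \<Rightarrow> bool" where
  "self_adjoint_on p f \<longleftrightarrow> (\<forall>c\<in>chains K p. \<forall>d\<in>chains K p.
     chain_inner K w p (f c) d = chain_inner K w p c (f d))"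

lemma self_adjoint_onD:
  "self_adjoint_on p f \<Longrightarrow> c \<in> chains K p \<Longrightarrow> d \<in> chains K p \<Longrightarrow>
    chain_inner K w p (f c) d = chain_inner K w p c (f d)"
  by (simp add: self_adjoint_on_def)

lemma chain_adjoint_eq_self_iff:
  assumes f: "f \<in> chain_maps K p p"
  shows "chain_adjoint K w p p f = f \<longleftrightarrow> self_adjoint_on p f"
proof
  assume "chain_adjoint K w p p f = f"
  then show "self_adjoint_on p f" using chain_inner_adjoint[OF f] by (simp add: self_adjoint_on_def)
next
  assume "self_adjoint_on p f"
  then show "chain_adjoint K w p p f = f"
    by (intro chain_adjoint_eqI[OF f f]) (rule self_adjoint_onD)
qed

text \<open>The Penrose conditions in terms of the inner product instead of adjoint maps.\<close>

definition penrose_inverse ::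
    "int \<Rightarrow> int \<Rightarrow> (('a set \<Rightarrow> real) \<Rightarrow> ('a set \<Rightarrow> real)) \<Rightarrow> (('a set \<Rightarrow> real) \<Rightarrow> ('a set \<Rightarrow> real)) \<Rightarrow> bool"
  where
  "penrose_inverse p q f g \<longleftrightarrow> g \<in> chain_maps K q p \<and>
     (\<forall>c\<in>chains K p. f (g (f c)) = f c) \<and> (\<forall>d\<in>chains K q. g (f (g d)) = g d) \<and>
     self_adjoint_on q (compose (chains K q) f g) \<and> self_adjoint_on p (compose (chains K p) g f)"

text \<open>Penrose's argument: \<open>f g = (f h) (f g)\<close> is, by self-adjointness of both factors, the adjoint
  of \<open>(f g) (f h) = f h\<close>, hence equal to \<open>f h\<close>; likewise \<open>g f = h f\<close>. Then
  \<open>g = g f g = h f h = h\<close>.\<close>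

lemma penrose_inverse_unique:
  assumes f: "f \<in> chain_maps K p q" and g: "penrose_inverse p q f g" and h: "penrose_inverse p q f h"
  shows "g = h"
proof -
  have gm: "g \<in> chain_maps K q p" and hm: "h \<in> chain_maps K q p"
    using g h by (auto simp: penrose_inverse_def)
  note [simp] = chain_map_in_chains[OF f] chain_map_in_chains[OF gm] chain_map_in_chains[OF hm]
  have fg: "chain_inner K w q (f (g c)) d = chain_inner K w q c (f (g d))"
    and fh: "chain_inner K w q (f (h c)) d = chain_inner K w q c (f (h d))"
    if "c \<in> chains K q" "d \<in> chains K q" for c d
    using that g h by (auto simp: penrose_inverse_def self_adjoint_on_def compose_def)
  have gf: "chain_inner K w p (g (f c)) d = chain_inner K w p c (g (f d))"
    and hf: "chain_inner K w p (h (f c)) d = chain_inner K w p c (h (f d))"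
    if "c \<in> chains K p" "d \<in> chains K p" for c d
    using that g h by (auto simp: penrose_inverse_def self_adjoint_on_def compose_def)
  have fgf: "f (g (f c)) = f c" and fhf: "f (h (f c)) = f c" if "c \<in> chains K p" for c
    using that g h by (auto simp: penrose_inverse_def)
  have same_range: "f (g d) = f (h d)" if d: "d \<in> chains K q" for d
  proof (rule chain_eqI_inner[of _ q])
    fix e assume e: "e \<in> chains K q"
    have "chain_inner K w q (f (g d)) e = chain_inner K w q (f (h (f (g d)))) e"
      using d by (simp add: fhf)
    also have "\<dots> = chain_inner K w q d (f (g (f (h e))))" using d e by (simp add: fh fg)
    also have "\<dots> = chain_inner K w q (f (h d)) e" using d e by (simp add: fgf fh)
    finally show "chain_inner K w q (f (g d)) e = chain_inner K w q (f (h d)) e" .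
  qed (use d in simp_all)
  have same_corange: "g (f c) = h (f c)" if c: "c \<in> chains K p" for c
  proof (rule chain_eqI_inner[of _ p])
    fix e assume e: "e \<in> chains K p"
    have "chain_inner K w p (g (f c)) e = chain_inner K w p (g (f (h (f c)))) e"
      using c by (simp add: fhf)
    also have "\<dots> = chain_inner K w p c (h (f (g (f e))))" using c e by (simp add: gf hf)
    also have "\<dots> = chain_inner K w p (h (f c)) e" using c e by (simp add: fgf hf)
    finally show "chain_inner K w p (g (f c)) e = chain_inner K w p (h (f c)) e" .
  qed (use c in simp_all)
  show ?thesis
  proof (rule chain_map_ext[OF gm hm])
    fix d assume d: "d \<in> chains K q"
    have "g d = g (f (g d))" using g d by (simp add: penrose_inverse_def)
    also have "\<dots> = h (f (h d))" using d by (simp add: same_range same_corange)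
    also have "\<dots> = h d" using h d by (simp add: penrose_inverse_def)
    finally show "g d = h d" .
  qed
qed

lemma chain_pinv_eqI:
  assumes f: "f \<in> chain_maps K p q" and g: "penrose_inverse p q f g"
  shows "chain_pinv K w p q f = g"
proof -
  have "penrose_inverse p q f h \<longleftrightarrow> h \<in> chain_maps K q p \<and>
     (\<forall>c\<in>chains K p. f (h (f c)) = f c) \<and>
     (\<forall>d\<in>chains K q. h (f (h d)) = h d) \<and>
     chain_adjoint K w q q (compose (chains K q) f h) = compose (chains K q) f h \<and>
     chain_adjoint K w p p (compose (chains K p) h f) = compose (chains K p) h f" for h
    using chain_map_compose[OF f, of h q] chain_map_compose[OF _ f, of h p]
    by (auto simp: penrose_inverse_def chain_adjoint_eq_self_iff)
  then have "chain_pinv K w p q f = (THE h. penrose_inverse p q f h)"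
    by (simp add: chain_pinv_def)
  also have "\<dots> = g" using penrose_inverse_unique[OF f] g by blast
  finally show ?thesis .
qed

text \<open>The kernel of a self-adjoint \<open>L\<close> is the orthogonal complement of its range. Hence \<open>L\<close> is
  injective on its range, and the range of \<open>L\<close> is that of \<open>L\<^sup>2\<close>. So for every \<open>d\<close> there is exactly
  one \<open>x\<close> in the range of \<open>L\<close> with \<open>L (L x) = L d\<close>, which says that \<open>L x\<close> is the
  projection of \<open>d\<close> onto the range; this \<open>x\<close> is the value of the pseudoinverse at \<open>d\<close>.\<close>

lemma self_adjoint_penrose_inverse:
  assumes L: "L \<in> chain_maps K q q" and sa: "self_adjoint_on q L"
  shows "penrose_inverse q q L (chain_pinv K w q q L)"
proof -
  note [simp] = chain_map_in_chains[OF L]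
  note Lsa = self_adjoint_onD[OF sa]
  have inj: "L c = L d" if eq: "L (L c) = L (L d)" and c: "c \<in> chains K q" and d: "d \<in> chains K q" for c d
  proof -
    define z where "z = (\<lambda>\<tau>. c \<tau> - d \<tau>)"
    have z: "z \<in> chains K q" unfolding z_def by (rule chains_diff[OF c d])
    have Lz: "L z = (\<lambda>\<tau>. L c \<tau> - L d \<tau>)" unfolding z_def by (rule chain_map_diff[OF L c d])
    have "L (L z) = (\<lambda>\<tau>. 0)" unfolding Lz using chain_map_diff[OF L, of "L c" "L d"] eq c d by simp
    then have "chain_inner K w q (L z) (L z) = 0"
      using Lsa[of "L z" z] z by (simp add: chain_inner_zero_left)
    then have "L z = (\<lambda>\<tau>. 0)" using chain_inner_self_eq_0[of "L z" q] z by simp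
    then show ?thesis unfolding Lz by (simp add: fun_eq_iff)
  qed
  \<comment> \<open>The residual of the projection is orthogonal to the range of \<open>L\<close>, so \<open>L\<close> annihilates it.\<close>
  have LL: "\<exists>c\<in>chains K q. L d = L (L c)" if d: "d \<in> chains K q" for d
  proof -
    obtain c where c: "c \<in> chains K q" and
      orth: "\<forall>e\<in>chains K q. chain_inner K w q (\<lambda>\<tau>. d \<tau> - L c \<tau>) (L e) = 0"
      using orthogonal_projection_exists[OF L d] by blast
    have "L d = L (L c)"
    proof (rule chain_eqI_inner[of _ q])
      fix e assume e: "e \<in> chains K q"
      then have "chain_inner K w q d (L e) - chain_inner K w q (L c) (L e) = 0"
        using orth by (simp add: chain_inner_diff_left)
      then show "chain_inner K w q (L d) e = chain_inner K w q (L (L c)) e"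
        using Lsa e c d by simp
    qed (use c d in simp_all)
    then show ?thesis using c by blast
  qed
  define P where "P = (\<lambda>d x. x \<in> L ` chains K q \<and> L (L x) = L d)"
  have P_ex: "\<exists>x. P d x" if d: "d \<in> chains K q" for d
  proof -
    obtain c where c: "c \<in> chains K q" "L d = L (L c)" using LL[OF d] by blast
    obtain e where e: "e \<in> chains K q" "L c = L (L e)" using LL[OF c(1)] by blast
    have "P d (L e)" using c e by (auto simp: P_def)
    then show ?thesis by blast
  qed
  have P_unique: "x = y" if x: "P d x" and y: "P d y" for d x y
  proof -
    obtain a b where ab: "a \<in> chains K q" "x = L a" "b \<in> chains K q" "y = L b"
      using x y by (auto simp: P_def)
    have "L (L x) = L (L y)" using x y by (simp add: P_def)
    then have "L x = L y" by (rule inj) (simp_all add: ab)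
    then show ?thesis unfolding ab by (rule inj) (rule ab)+
  qed
  define g where "g = (\<lambda>d\<in>chains K q. THE x. P d x)"
  have Pg: "P d (g d)" if "d \<in> chains K q" for d
  proof -
    have "\<exists>!x. P d x" using P_ex[OF that] P_unique by blast
    then show ?thesis unfolding g_def using that by (simp add: theI')
  qed
  have g_eqI: "g d = x" if "d \<in> chains K q" "P d x" for d x
    using P_unique[OF Pg[OF that(1)] that(2)] .
  have g_chains [simp]: "g d \<in> chains K q" if "d \<in> chains K q" for d
    using Pg[OF that] by (auto simp: P_def)
  have LLg: "L (L (g d)) = L d" if "d \<in> chains K q" for d
    using Pg[OF that] by (simp add: P_def)
  have gm: "g \<in> chain_maps K q q"
    unfolding chain_maps_def
  proof (intro CollectI conjI allI ballI)
    show "g \<in> chains K q \<rightarrow>\<^sub>E chains K q" using g_chains by (auto simp: g_def)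
  next
    fix a b c d assume c: "c \<in> chains K q" and d: "d \<in> chains K q"
    obtain u v where uv: "u \<in> chains K q" "g c = L u" "v \<in> chains K q" "g d = L v"
      using Pg[OF c] Pg[OF d] by (auto simp: P_def)
    have "(\<lambda>\<tau>. a * g c \<tau> + b * g d \<tau>) = L (\<lambda>\<tau>. a * u \<tau> + b * v \<tau>)"
      using uv by (simp add: chain_map_lincomb[OF L])
    moreover have "L (L (\<lambda>\<tau>. a * g c \<tau> + b * g d \<tau>)) = L (\<lambda>\<sigma>. a * c \<sigma> + b * d \<sigma>)"
      using c d by (simp add: chain_map_lincomb[OF L] LLg)
    ultimately have "P (\<lambda>\<sigma>. a * c \<sigma> + b * d \<sigma>) (\<lambda>\<tau>. a * g c \<tau> + b * g d \<tau>)"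
      using uv chains_lincomb by (auto simp: P_def)
    then show "g (\<lambda>\<sigma>. a * c \<sigma> + b * d \<sigma>) = (\<lambda>\<tau>. a * g c \<tau> + b * g d \<tau>)"
      using g_eqI chains_lincomb[OF c d] by blast
  qed
  have LgL: "L (g (L d)) = L d" if "d \<in> chains K q" for d
    by (rule inj) (use that in \<open>simp_all add: LLg\<close>)
  have comm: "g (L d) = L (g d)" if "d \<in> chains K q" for d
    by (rule g_eqI) (use that in \<open>auto simp: P_def LLg\<close>)
  have gLg: "g (L (g d)) = g d" if "d \<in> chains K q" for d
    by (rule g_eqI) (use that Pg[OF that] in \<open>auto simp: P_def\<close>)
  have Lg_sym: "chain_inner K w q (L (g c)) d = chain_inner K w q (L (g c)) (L (g d))"
    if c: "c \<in> chains K q" and d: "d \<in> chains K q" for c d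
    using Lsa[of "g c" d] Lsa[of "g c" "L (g d)"] c d by (simp add: LLg)
  have Lg_sa: "chain_inner K w q (L (g c)) d = chain_inner K w q c (L (g d))"
    if c: "c \<in> chains K q" and d: "d \<in> chains K q" for c d
    using Lg_sym[OF c d] Lg_sym[OF d c] chain_inner_commute by metis
  have "penrose_inverse q q L g"
    using gm LgL gLg Lg_sa by (auto simp: penrose_inverse_def self_adjoint_on_def compose_def comm)
  then show ?thesis using chain_pinv_eqI[OF L] by metis
qed

section \<open>Effective resistances as diagonal entries of a projection\<close>

lemma laplacian_penrose_inverse:
  fixes f p q
  defines "L \<equiv> compose (chains K q) f (chain_adjoint K w p q f)"
  assumes f: "f \<in> chain_maps K p q"
  shows "penrose_inverse q q L (chain_pinv K w q q L)"
proof (rule self_adjoint_penrose_inverse)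
  note fa = chain_adjoint_in_chain_maps[OF f]
  show "L \<in> chain_maps K q q" unfolding L_def by (rule chain_map_compose[OF f fa])
  show "self_adjoint_on q L"
    unfolding self_adjoint_on_def
  proof (intro ballI)
    fix c e assume ce: "c \<in> chains K q" "e \<in> chains K q"
    then have "chain_adjoint K w p q f c \<in> chains K p" "chain_adjoint K w p q f e \<in> chains K p"
      using chain_map_in_chains[OF fa] by auto
    then show "chain_inner K w q (L c) e = chain_inner K w q c (L e)"
      using ce chain_inner_adjoint[OF f, of "chain_adjoint K w p q f c" e]
        chain_inner_adjoint[OF f, of "chain_adjoint K w p q f e" c]
      by (simp add: L_def compose_def chain_inner_commute)
  qed
qed

text \<open>For \<open>L = f f*\<close> the chain \<open>z = L\<^sup>+ L d - d\<close> satisfies \<open>L z = 0\<close>. Then the square of the norm of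
  \<open>f* z\<close>, which is the inner product of \<open>L z\<close> and \<open>z\<close>, vanishes.\<close>

lemma adjoint_pinv_laplacian:
  fixes f p q
  defines "L \<equiv> compose (chains K q) f (chain_adjoint K w p q f)"
  assumes f: "f \<in> chain_maps K p q" and d: "d \<in> chains K q"
  shows "chain_adjoint K w p q f (chain_pinv K w q q L (f (chain_adjoint K w p q f d))) =
           chain_adjoint K w p q f d"
proof -
  let ?fa = "chain_adjoint K w p q f"
  let ?g = "chain_pinv K w q q L"
  note fa = chain_adjoint_in_chain_maps[OF f]
  have g: "penrose_inverse q q L ?g" unfolding L_def by (rule laplacian_penrose_inverse[OF f])
  then have gm: "?g \<in> chain_maps K q q" by (simp add: penrose_inverse_def)
  note [simp] = chain_map_in_chains[OF f] chain_map_in_chains[OF fa] chain_map_in_chains[OF gm]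
  let ?x = "?g (f (?fa d))"
  have x: "?x \<in> chains K q" using d by simp
  define z where "z = (\<lambda>\<tau>. ?x \<tau> - d \<tau>)"
  have z: "z \<in> chains K q" unfolding z_def by (rule chains_diff[OF x d])
  have faz: "?fa z = (\<lambda>\<sigma>. ?fa ?x \<sigma> - ?fa d \<sigma>)" unfolding z_def by (rule chain_map_diff[OF fa x d])
  have "L ?x = L d" using g d by (simp add: penrose_inverse_def L_def compose_def)
  then have "f (?fa ?x) = f (?fa d)" using x d by (simp add: L_def compose_def)
  then have "f (?fa z) = (\<lambda>\<tau>. 0)" unfolding faz using x d by (simp add: chain_map_diff[OF f])
  then have "chain_inner K w p (?fa z) (?fa z) = 0"
    using chain_inner_adjoint[OF f, of "?fa z" z] z by (simp add: chain_inner_zero_left)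
  then have "?fa z = (\<lambda>\<sigma>. 0)" using chain_inner_self_eq_0[of "?fa z" p] z by simp
  then show ?thesis unfolding faz by (simp add: fun_eq_iff)
qed

lemma sum_simplices_nth:
  assumes "distinct xs" "set xs = simplices K p"
  shows "(\<Sum>\<sigma>\<in>simplices K p. h \<sigma>) = (\<Sum>i<length xs. h (xs ! i))"
  using sum.reindex_bij_betw[OF bij_betw_nth[OF assms(1) refl assms(2)[symmetric]], of h] by simp

text \<open>The matrix of \<open>f*\<close> is \<open>W\<^sub>p A W\<^sub>q\<^sup>-\<^sup>1\<close>, where \<open>A\<close> is the transposed matrix of \<open>f\<close> and \<open>W\<close> stands for
  the diagonal matrices of the weights. The statement is about the trace of \<open>P = f* L\<^sup>+ f\<close>. The
  conjugate \<open>W\<^sub>p\<^sup>-\<^sup>1 P W\<^sub>p\<close> has the same trace; it has the form \<open>A X\<close> with \<open>X = W\<^sub>q\<^sup>-\<^sup>1 L\<^sup>+ A\<^sup>T W\<^sub>p\<close>,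
  and \<open>P f* = f*\<close> becomes \<open>A X A = A\<close>.\<close>

lemma weighted_resistance_sum_eq_rank:
  fixes f p q xs ys
  defines "L \<equiv> compose (chains K q) f (chain_adjoint K w p q f)"
    and "A \<equiv> mat (length xs) (length ys) (\<lambda>(i, j). f (indicator {xs ! i}) (ys ! j))"
  assumes f: "f \<in> chain_maps K p q"
    and xs: "distinct xs" "set xs = simplices K p"
    and ys: "distinct ys" "set ys = simplices K q"
  shows "(\<Sum>\<sigma>\<in>simplices K p. w \<sigma> * chain_inner K w p
           (chain_adjoint K w p q f (chain_pinv K w q q L (f (indicator {\<sigma>})))) (indicator {\<sigma>})) =
         real (vec_space.rank (length xs) A)"
proof -
  let ?fa = "chain_adjoint K w p q f"
  let ?g = "chain_pinv K w q q L"
  note fa = chain_adjoint_in_chain_maps[OF f]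
  have gm: "?g \<in> chain_maps K q q"
    using laplacian_penrose_inverse[OF f] by (simp add: L_def penrose_inverse_def)
  define P where "P = compose (chains K p) ?fa (compose (chains K p) ?g f)"
  have P: "P \<in> chain_maps K p p"
    unfolding P_def by (rule chain_map_compose[OF fa chain_map_compose[OF gm f]])
  have P_app: "P c = ?fa (?g (f c))" if "c \<in> chains K p" for c
    using that by (simp add: P_def compose_def)
  have P_fa: "P (?fa d) = ?fa d" if d: "d \<in> chains K q" for d
    using adjoint_pinv_laplacian[OF f d] chain_map_in_chains[OF fa d] by (simp add: P_app L_def)
  have x: "xs ! i \<in> simplices K p" "w (xs ! i) \<noteq> 0" if "i < length xs" for i
    using that xs(2) nth_mem simplex_weight_pos less_irrefl by metis+
  have y: "ys ! j \<in> simplices K q" "w (ys ! j) \<noteq> 0" if "j < length ys" for j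
    using that ys(2) nth_mem simplex_weight_pos less_irrefl by metis+
  define X where "X = mat (length ys) (length xs) (\<lambda>(j, k).
    inverse (w (ys ! j)) * ?g (f (indicator {xs ! k})) (ys ! j) * w (xs ! k))"
  have A: "A \<in> carrier_mat (length xs) (length ys)" by (simp add: A_def)
  have X: "X \<in> carrier_mat (length ys) (length xs)" by (simp add: X_def)
  have AX: "(A * X) $$ (i, k) = inverse (w (xs ! i)) * P (indicator {xs ! k}) (xs ! i) * w (xs ! k)"
    if i: "i < length xs" and k: "k < length xs" for i k
  proof -
    let ?y = "?g (f (indicator {xs ! k}))"
    have yk: "?y \<in> chains K q"
      using indicator_in_chains[OF x(1)[OF k]] chain_map_in_chains[OF f] chain_map_in_chains[OF gm] by simp
    have "(A * X) $$ (i, k) = (\<Sum>j<length ys. f (indicator {xs ! i}) (ys ! j) *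
        (inverse (w (ys ! j)) * ?y (ys ! j) * w (xs ! k)))"
      using i k by (simp add: A_def X_def scalar_prod_def lessThan_atLeast0)
    also have "\<dots> = chain_inner K w q (f (indicator {xs ! i})) ?y * w (xs ! k)"
      by (simp add: chain_inner_def sum_simplices_nth[OF ys] sum_distrib_left sum_distrib_right mult_ac)
    also have "chain_inner K w q (f (indicator {xs ! i})) ?y = inverse (w (xs ! i)) * ?fa ?y (xs ! i)"
      using chain_adjoint_apply[OF f yk x(1)[OF i]] x(2)[OF i] by simp
    finally show ?thesis using P_app[OF indicator_in_chains[OF x(1)[OF k]]] by simp
  qed
  have "A * X * A = A"
  proof (rule eq_matI)
    fix i j assume "i < dim_row A" "j < dim_col A"
    then have i: "i < length xs" and j: "j < length ys" using A by auto
    let ?t = "?fa (indicator {ys ! j})"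
    have yj: "indicator {ys ! j} \<in> chains K q" by (rule indicator_in_chains[OF y(1)[OF j]])
    have fa_j: "w (xs ! k) * f (indicator {xs ! k}) (ys ! j) = w (ys ! j) * ?t (xs ! k)"
      if "k < length xs" for k
      using chain_adjoint_apply[OF f yj x(1)[OF that]] chain_inner_indicator_right[OF y(1)[OF j]]
        y(2)[OF j] by simp
    have "(A * X * A) $$ (i, j) = (\<Sum>k<length xs. (A * X) $$ (i, k) * A $$ (k, j))"
      using i j A X by (simp add: scalar_prod_def lessThan_atLeast0 del: assoc_mult_mat)
    also have "\<dots> = (\<Sum>k<length xs. inverse (w (xs ! i)) * w (ys ! j) *
        (?t (xs ! k) * P (indicator {xs ! k}) (xs ! i)))"
    proof (intro sum.cong refl)
      fix k assume "k \<in> {..<length xs}"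
      then have k: "k < length xs" by simp
      have "(A * X) $$ (i, k) * A $$ (k, j) = inverse (w (xs ! i)) * P (indicator {xs ! k}) (xs ! i) *
          (w (xs ! k) * f (indicator {xs ! k}) (ys ! j))"
        using AX[OF i k] k j by (simp add: A_def)
      then show "(A * X) $$ (i, k) * A $$ (k, j) = inverse (w (xs ! i)) * w (ys ! j) *
          (?t (xs ! k) * P (indicator {xs ! k}) (xs ! i))"
        by (simp add: fa_j[OF k])
    qed
    also have "\<dots> = inverse (w (xs ! i)) * w (ys ! j) * P ?t (xs ! i)"
      using chain_map_expand[OF P chain_map_in_chains[OF fa yj]]
      by (simp add: sum_simplices_nth[OF xs] sum_distrib_left)
    also have "\<dots> = f (indicator {xs ! i}) (ys ! j)"
      using P_fa[OF yj] fa_j[OF i, symmetric] x(2)[OF i] by (simp add: mult.assoc)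
    finally show "(A * X * A) $$ (i, j) = A $$ (i, j)" using i j by (simp add: A_def)
  qed (use A X in auto)
  then have "(\<Sum>i<length xs. (A * X) $$ (i, i)) = real (vec_space.rank (length xs) A)"
    by (rule trace_projection_eq_rank[OF A X])
  moreover have "(\<Sum>\<sigma>\<in>simplices K p. w \<sigma> * chain_inner K w p
      (?fa (?g (f (indicator {\<sigma>})))) (indicator {\<sigma>})) = (\<Sum>i<length xs. (A * X) $$ (i, i))"
    unfolding sum_simplices_nth[OF xs]
    by (intro sum.cong refl)
      (simp add: AX x chain_inner_indicator_right P_app indicator_in_chains)
  ultimately show ?thesis by simp
qed

section \<open>The boundary map\<close>

lemma boundary_in_chain_maps: "boundary K p \<in> chain_maps K p (p - 1)"
proof -
  define m :: "'a set \<Rightarrow> 'a set \<Rightarrow> real" where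
    "m \<sigma> \<tau> = (\<Sum>v\<in>\<sigma>. (- 1) ^ card {u \<in> \<sigma>. u < v} * indicator {\<sigma> - {v}} \<tau>)" for \<sigma> \<tau>
  have boundary: "boundary K p = (\<lambda>c\<in>chains K p. \<lambda>\<tau>.
      if \<tau> \<in> simplices K (p - 1) then \<Sum>\<sigma>\<in>simplices K p. c \<sigma> * m \<sigma> \<tau> else 0)"
    unfolding boundary_def m_def by (rule refl)
  have "boundary K p \<in> chains K p \<rightarrow>\<^sub>E chains K (p - 1)"
    by (auto simp: boundary chains_def)
  then show ?thesis
    by (simp add: chain_maps_def)
      (simp add: boundary chains_lincomb fun_eq_iff sum.distrib sum_distrib_left algebra_simps)
qed

lemma simplex_list:
  "distinct (simplex_list K p)" "set (simplex_list K p) = simplices K p"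
proof -
  have fin: "finite \<sigma>" if "\<sigma> \<in> simplices K p" for \<sigma>
    using that complex by (auto simp: simplices_def finite_simplicial_complex_def)
  have "set (simplex_list K p) = (\<lambda>\<sigma>. set (sorted_list_of_set \<sigma>)) ` simplices K p"
    by (simp add: simplex_list_def finite_simplices image_image)
  also have "\<dots> = simplices K p" using fin by (simp add: image_cong[OF refl, of _ _ id])
  finally show "set (simplex_list K p) = simplices K p" .
  show "distinct (simplex_list K p)"
    using fin by (auto simp: simplex_list_def distinct_map finite_simplices inj_on_def)
qed

lemma length_simplex_list: "length (simplex_list K p) = card (simplices K p)"
  using simplex_list distinct_card by metis

end

theorem corollary8p4:
  fixes K :: "'a::linorder set set" and w :: "'a set \<Rightarrow> real" and p :: int
  assumes "finite_simplicial_complex K"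
    and "\<forall>\<sigma>\<in>K. w \<sigma> > 0"
    and "p \<ge> 0"
  shows "(\<Sum>\<sigma>\<in>simplices K p. w \<sigma> * effective_resistance K w p \<sigma>)
           = real (mat_rank (boundary_matrix K p)\<^sup>T)
       \<and> real (mat_rank (boundary_matrix K p)\<^sup>T)
           = real (card (simplices K (p - 1))) - real (kernel_dim (boundary_matrix K p)\<^sup>T)"
proof -
  interpret weighted_complex K w using assms by unfold_locales
  let ?B = "boundary_matrix K p"
  let ?xs = "simplex_list K p" and ?ys = "simplex_list K (p - 1)"
  have BT: "?B\<^sup>T \<in> carrier_mat (length ?xs) (length ?ys)"
    by (simp add: boundary_matrix_def length_simplex_list)
  have rank: "mat_rank ?B\<^sup>T = vec_space.rank (length ?xs) ?B\<^sup>T"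
    using BT by (simp add: mat_rank_def)
  have "?B\<^sup>T = mat (length ?xs) (length ?ys) (\<lambda>(i, j). boundary K p (indicator {?xs ! i}) (?ys ! j))"
    by (rule eq_matI) (auto simp: boundary_matrix_def length_simplex_list)
  then have "(\<Sum>\<sigma>\<in>simplices K p. w \<sigma> * effective_resistance K w p \<sigma>) = real (mat_rank ?B\<^sup>T)"
    using weighted_resistance_sum_eq_rank[OF boundary_in_chain_maps simplex_list simplex_list, of p]
    unfolding rank by (simp add: effective_resistance_def up_laplacian_def boundary_adjoint_def)
  moreover have "mat_rank ?B\<^sup>T + kernel_dim ?B\<^sup>T = card (simplices K (p - 1))"
    using rank_plus_kernel_dim[OF BT] by (simp add: rank length_simplex_list)
  ultimately show ?thesis by linarith
qed

end
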